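(* Let $f:X\to\mathcal P(Z)$ be a set-valued function. The following statements are equivalent: (i) $f$ is the pointwise supremum of its $M_f$-affine minorants, i.e. $f(x)+K=\bigcap_{a\in\mathcal H_f}(a(x)+K)$ for all $x\in X$; (ii) $f$ is $K$-e-convex and either $f_K$ is proper, or $f_K\equiv\emptyset$, or $f_K\equiv Z$.
   Context: $X$ and $Z$ are nontrivial real separated (Hausdorff) locally convex spaces with topological duals $X^*,Z^*$ and duality pairings $\langle\cdot,\cdot\rangle$. $K\subset Z$ is a fixed convex cone with $\{0\}\subsetneq K\subsetneq Z$, and $K^*=\{z^*\in Z^*:\langle z,z^*\rangle\le 0\ \forall z\in K\}$. $\mathcal P(Z)$ is the set of all subsets of $Z$ (including $\emptyset$); $A+B$ is the Minkowski sum, with $A+\emptyset=\emptyset$. For $A,B\subseteq Z$, $A\le_K B$ means $B\subseteq A+K$. A subset $C$ of a locally convex space $Y$ is e-convex if it is the intersection of a (possibly empty) family of open half-spaces; equivalently, for every $y_0\notin C$ there is $y^*\in Y^*$ with $\langle y-y_0,y^*\rangle<0$ for all $y\in C$. $\operatorname{e-conv}C$ is the smallest e-convex set containing $C$. $\mathcal R_K(Z)=\{A\subseteq Z: A=\operatorname{e-conv}(A+K)\}$. For $f:X\to\mathcal P(Z)$: $f_K(x)=f(x)+K$; $\operatorname{dom}f=\{x: f(x)\ne\emptyset\}$; $f$ is proper if $\operatorname{dom}f\neq\emptyset$ and $f(x)\ne Z$ for all $x\in\operatorname{dom}f$; $\operatorname{epi}_Kf=\{(x,z)\in X\times Z: z\in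 f(x)+K\}$; $f$ is $K$-e-convex if $\operatorname{epi}_Kf$ is an e-convex set in $X\times Z$. For $x^*\in X^*$, $z^*\in K^*\setminus\{0\}$: $S_{(x^*,z^* )}(x)=\{z\in Z:\langle x,x^*\rangle+\langle z,z^*\rangle<0\}$. For $C\subseteq X$, $a:X\to\mathcal P(Z)$ is $C$-affine if there are $x^*\in X^*$, $z^*\in K^*\setminus\{0\}$, $\tilde z\in Z$ with $a(x)=S_{(x^*,z^* )}(x)+\tilde z$ for $x\in C$ and $a(x)=\emptyset$ otherwise. $M_f=\operatorname{e-conv}(\operatorname{dom}f)$, and $\mathcal H_f$ is the set of all $M_f$-affine functions $a:X\to\mathcal R_K(Z)$ with $a(x)\le_K f(x)$ for all $x\in X$ (the $M_f$-affine minorants of $f$); if $f\equiv\emptyset$, then $M_f=\emptyset$ and $\mathcal H_f=\{f\}$. The intersection (supremum) over an empty family is $Z$. *)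

theory Defs
  imports "HOL-Analysis.Analysis"
begin

section \<open>Locally convex spaces\<close>

text \<open>
  Real separated (Hausdorff) locally convex topological vector spaces. Sort inference does not
  admit the constant \<open>convex\<close> in the class specification, so its definition is written out.
\<close>

class locally_convex_space = real_vector + topological_ab_group_add + t2_space +
  assumes tendsto_scaleR_nhds:
      "((\<lambda>p. fst p *\<^sub>R snd p) \<longlongrightarrow> c *\<^sub>R x) (nhds (c::real) \<times>\<^sub>F nhds x)"
    and convex_open_nhds_base_raw:
      "open U \<Longrightarrow> 0 \<in> U \<Longrightarrow>
         \<exists>V. open V \<and> 0 \<in> V \<and> V \<subseteq> U \<and>
           (\<forall>x\<in>V. \<forall>y\<in>V. \<forall>u\<ge>0. \<forall>v\<ge>0. u + v = 1 \<longrightarrow> u *\<^sub>R x + v *\<^sub>R y \<in> V)"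

lemma convex_open_nhds_base:
  fixes U :: "'a::locally_convex_space set"
  assumes "open U" "0 \<in> U"
  obtains V where "open V" "0 \<in> V" "convex V" "V \<subseteq> U"
  using convex_open_nhds_base_raw[OF assms] unfolding convex_def by blast

text \<open>
  The dual and evenly convex sets are defined for every real vector space with a topology, so that
  they apply to product types, which carry the product topology. An instance
  \<open>prod :: (locally_convex_space, locally_convex_space) locally_convex_space\<close> is not possible: it
  would clash with the library's arity of \<open>prod\<close> for \<open>topological_comm_monoid_add\<close>, which is declared
  for \<open>real_normed_vector\<close>.
\<close>

definition topological_dual :: "('a::{real_vector, topological_space} \<Rightarrow> real) set" where
  "topological_dual = {\<phi>. linear \<phi> \<and> continuous_on UNIV \<phi>}"

definition polar_cone :: "'a::locally_convex_space set \<Rightarrow> ('a \<Rightarrow> real) set" where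
  "polar_cone K = {\<phi> \<in> topological_dual. \<forall>z\<in>K. \<phi> z \<le> 0}"


section \<open>Evenly convex sets\<close>

definition open_halfspace :: "'a::{real_vector, topological_space} set \<Rightarrow> bool" where
  "open_halfspace H \<longleftrightarrow>
     (\<exists>\<phi> \<in> topological_dual - {\<lambda>_. 0}. \<exists>c. H = {y. \<phi> y < c})"

text \<open>The family may be empty, since \<open>\<Inter>{} = UNIV\<close>.\<close>

definition e_convex :: "'a::{real_vector, topological_space} set \<Rightarrow> bool" where
  "e_convex C \<longleftrightarrow> (\<exists>F. (\<forall>H\<in>F. open_halfspace H) \<and> C = \<Inter>F)"

definition e_conv :: "'a::{real_vector, topological_space} set \<Rightarrow> 'a set" where
  "e_conv C = e_convex hull C"

definition R_sets :: "'z::locally_convex_space set \<Rightarrow> 'z set set" where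
  "R_sets K = {A. A = e_conv (A + K)}"


section \<open>Set-valued functions\<close>

definition le_cone :: "'z::locally_convex_space set \<Rightarrow> 'z set \<Rightarrow> 'z set \<Rightarrow> bool" where
  "le_cone K A B \<longleftrightarrow> B \<subseteq> A + K"

definition sv_plus :: "'z::locally_convex_space set \<Rightarrow> ('x \<Rightarrow> 'z set) \<Rightarrow> 'x \<Rightarrow> 'z set" where
  "sv_plus K f = (\<lambda>x. f x + K)"

definition sv_dom :: "('x \<Rightarrow> 'z set) \<Rightarrow> 'x set" where
  "sv_dom f = {x. f x \<noteq> {}}"

definition sv_proper :: "('x \<Rightarrow> 'z set) \<Rightarrow> bool" where
  "sv_proper f \<longleftrightarrow> sv_dom f \<noteq> {} \<and> (\<forall>x\<in>sv_dom f. f x \<noteq> UNIV)"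

definition sv_epi :: "'z::locally_convex_space set \<Rightarrow> ('x \<Rightarrow> 'z set) \<Rightarrow> ('x \<times> 'z) set" where
  "sv_epi K f = {(x, z). z \<in> f x + K}"

definition K_e_convex ::
  "'z::locally_convex_space set \<Rightarrow> ('x::locally_convex_space \<Rightarrow> 'z set) \<Rightarrow> bool" where
  "K_e_convex K f \<longleftrightarrow> e_convex (sv_epi K f)"

definition S_fun :: "('x \<Rightarrow> real) \<Rightarrow> ('z \<Rightarrow> real) \<Rightarrow> 'x \<Rightarrow> 'z set" where
  "S_fun \<phi> \<psi> x = {z. \<phi> x + \<psi> z < 0}"

definition C_affine ::
  "'z::locally_convex_space set \<Rightarrow> 'x::locally_convex_space set \<Rightarrow> ('x \<Rightarrow> 'z set) \<Rightarrow> bool" where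
  "C_affine K C a \<longleftrightarrow>
     (\<exists>\<phi> \<in> topological_dual. \<exists>\<psi> \<in> polar_cone K - {\<lambda>_. 0}. \<exists>w.
        \<forall>x. a x = (if x \<in> C then S_fun \<phi> \<psi> x + {w} else {}))"

definition M_set :: "('x::locally_convex_space \<Rightarrow> 'z set) \<Rightarrow> 'x set" where
  "M_set f = e_conv (sv_dom f)"

text \<open>
  The case \<open>f \<equiv> \<emptyset>\<close> is set apart because \<open>polar_cone K\<close> may consist of \<open>0\<close> only,
  and then no function is affine.
\<close>

definition affine_minorants ::
  "'z::locally_convex_space set \<Rightarrow> ('x::locally_convex_space \<Rightarrow> 'z set) \<Rightarrow> ('x \<Rightarrow> 'z set) set" where
  "affine_minorants K f =
     (if f = (\<lambda>_. {}) then {f}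
      else {a. C_affine K (M_set f) a \<and> (\<forall>x. a x \<in> R_sets K) \<and> (\<forall>x. le_cone K (a x) (f x))})"

end

theory Submission
  imports Defs
begin

text \<open>
  A functional on \<open>X \<times> Z\<close> strictly separating a point \<open>(x\<^sub>0, z\<^sub>0)\<close> from the epigraph splits as
  \<open>\<phi> x + \<psi> z\<close> with \<open>\<psi>\<close> in the polar cone, because the epigraph recedes along \<open>K\<close>. If \<open>\<psi> \<noteq> 0\<close>, it
  is an affine minorant cutting off \<open>(x\<^sub>0, z\<^sub>0)\<close>; if \<open>\<psi> = 0\<close>, then \<open>\<phi>\<close> separates \<open>x\<^sub>0\<close> from the
  domain, so \<open>x\<^sub>0\<close> lies outside its evenly convex hull, where every affine minorant is empty.
  The Hahn--Banach theorem is needed only for \<open>f \<equiv> \<emptyset>\<close>: the empty epigraph is evenly convex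
  because \<open>X \<times> Z\<close> has a nonzero dual. It is obtained by showing that minimal sublinear functionals
  are linear.
\<close>

section \<open>A nonzero continuous linear functional\<close>

definition sublinear :: "('a::real_vector \<Rightarrow> real) \<Rightarrow> bool" where
  "sublinear p \<longleftrightarrow> (\<forall>x y. p (x + y) \<le> p x + p y) \<and> (\<forall>c x. c > 0 \<longrightarrow> p (c *\<^sub>R x) \<le> c * p x)"

lemma sublinear_add: "sublinear p \<Longrightarrow> p (x + y) \<le> p x + p y"
  by (simp add: sublinear_def)

lemma sublinear_scaleR_le: "sublinear p \<Longrightarrow> c > 0 \<Longrightarrow> p (c *\<^sub>R x) \<le> c * p x"
  by (simp add: sublinear_def)

text \<open>Scaling \<open>c *\<^sub>R x\<close> back by \<open>1 / c\<close> yields the reverse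
  inequality, so \<open>sublinear\<close> asks for one direction only, which is the one that infima
  preserve easily.\<close>

lemma sublinear_scaleR_pos:
  assumes "sublinear p" "c > 0"
  shows "p (c *\<^sub>R x) = c * p x"
proof (rule antisym)
  have "p x \<le> (1 / c) * p (c *\<^sub>R x)"
    using sublinear_scaleR_le[OF assms(1), of "1 / c" "c *\<^sub>R x"] assms(2) by simp
  then show "c * p x \<le> p (c *\<^sub>R x)"
    using assms(2) by (simp add: field_simps)
qed (rule sublinear_scaleR_le[OF assms])

lemma sublinear_0: "sublinear p \<Longrightarrow> p 0 = 0"
  using sublinear_scaleR_pos[of p 2 0] by simp

lemma sublinear_minus_ge: "sublinear p \<Longrightarrow> - p (- x) \<le> p x"
  using sublinear_add[of p x "- x"] sublinear_0[of p] by simp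

text \<open>For odd \<open>p\<close>, subadditivity at \<open>- x\<close>, \<open>- y\<close> is
  superadditivity at \<open>x\<close>, \<open>y\<close>. This is the linearity test for minimal
  sublinear functionals.\<close>

lemma sublinear_odd_imp_linear:
  assumes p: "sublinear p" and odd: "\<And>x. p (- x) \<le> - p x"
  shows "linear p"
proof -
  have eq: "p (- x) = - p x" for x
    using odd[of x] sublinear_minus_ge[OF p, of x] by linarith
  have add: "p (x + y) = p x + p y" for x y
    using sublinear_add[OF p, of x y] sublinear_add[OF p, of "- x" "- y"] eq[of x] eq[of y]
      eq[of "x + y"] by (simp add: add.commute)
  have scale: "p (c *\<^sub>R x) = c * p x" for c x
  proof (cases c "0 :: real" rule: linorder_cases)
    case less
    then show ?thesis
      using sublinear_scaleR_pos[OF p, of "- c" x] eq[of "c *\<^sub>R x"] by simp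
  next
    case equal
    then show ?thesis by (simp add: sublinear_0[OF p])
  next
    case greater
    then show ?thesis by (rule sublinear_scaleR_pos[OF p])
  qed
  show ?thesis
    by (rule linearI) (simp_all add: add scale)
qed

text \<open>The witness is the infimum of \<open>q (x + t *\<^sub>R y) - t * q y\<close> over
  \<open>t \<ge> 0\<close>. If \<open>q\<close> is minimal, then \<open>q' = q\<close>, and the last
  property says that \<open>q\<close> is odd at \<open>y\<close>.\<close>

lemma sublinear_lower_at:
  fixes q :: "'a::real_vector \<Rightarrow> real"
  assumes q: "sublinear q"
  obtains q' where "sublinear q'" "q' \<le> q" "q' (- y) \<le> - q y"
proof
  define A where "A x t = q (x + t *\<^sub>R y) - t * q y" for x t
  define q' where "q' x = (INF t\<in>{0..}. A x t)" for x
  \<comment> \<open>The bound does not depend on \<open>t\<close>, so each infimum is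
    finite.\<close>
  have lower: "- q (- x) \<le> A x t" if "t \<ge> 0" for x t
  proof -
    have "q (t *\<^sub>R y) = t * q y"
      using that sublinear_scaleR_pos[OF q, of t y] sublinear_0[OF q] by (cases "t = 0") auto
    moreover have "q (t *\<^sub>R y) \<le> q (x + t *\<^sub>R y) + q (- x)"
      using sublinear_add[OF q, of "x + t *\<^sub>R y" "- x"] by simp
    ultimately show ?thesis by (simp add: A_def)
  qed
  have bdd: "bdd_below (A x ` {0..})" for x
    using lower by (auto intro!: bdd_belowI2)
  have q'_le: "q' x \<le> A x t" if "t \<ge> 0" for x t
    unfolding q'_def using that by (auto intro!: cINF_lower bdd)
  have q'_ge: "b \<le> q' x" if "\<And>t. t \<ge> 0 \<Longrightarrow> b \<le> A x t" for b x
    unfolding q'_def using that by (auto intro!: cINF_greatest)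
  have add: "q' (x\<^sub>1 + x\<^sub>2) \<le> q' x\<^sub>1 + q' x\<^sub>2" for x\<^sub>1 x\<^sub>2
  proof -
    have A2: "q' (x\<^sub>1 + x\<^sub>2) \<le> A x\<^sub>1 t + A x\<^sub>2 s" if "t \<ge> 0" "s \<ge> 0" for t s
    proof -
      \<comment> \<open>The parameters add up: \<open>t + s\<close> is admissible for the sum of the
        two arguments.\<close>
      have "q' (x\<^sub>1 + x\<^sub>2) \<le> A (x\<^sub>1 + x\<^sub>2) (t + s)"
        using that by (intro q'_le) simp
      also have "\<dots> \<le> A x\<^sub>1 t + A x\<^sub>2 s"
        using sublinear_add[OF q, of "x\<^sub>1 + t *\<^sub>R y" "x\<^sub>2 + s *\<^sub>R y"]
        by (simp add: A_def algebra_simps)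
      finally show ?thesis .
    qed
    have "q' (x\<^sub>1 + x\<^sub>2) - A x\<^sub>1 t \<le> q' x\<^sub>2" if "t \<ge> 0" for t
      by (rule q'_ge) (use A2[OF that] in \<open>simp add: algebra_simps\<close>)
    then have "q' (x\<^sub>1 + x\<^sub>2) - q' x\<^sub>2 \<le> q' x\<^sub>1"
      by (intro q'_ge) (simp add: algebra_simps)
    then show ?thesis by simp
  qed
  have scale: "q' (c *\<^sub>R x) \<le> c * q' x" if c: "c > 0" for c x
  proof -
    have "q' (c *\<^sub>R x) / c \<le> q' x"
    proof (rule q'_ge)
      fix t :: real assume t: "t \<ge> 0"
      have "q' (c *\<^sub>R x) \<le> A (c *\<^sub>R x) (c * t)"
        using c t by (intro q'_le) simp
      also have "\<dots> = c * A x t"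
        using sublinear_scaleR_pos[OF q c, of "x + t *\<^sub>R y"] by (simp add: A_def algebra_simps)
      finally show "q' (c *\<^sub>R x) / c \<le> A x t"
        using c by (simp add: field_simps)
    qed
    then show ?thesis using c by (simp add: field_simps)
  qed
  show "sublinear q'"
    using add scale by (simp add: sublinear_def)
  show "q' \<le> q"
    using q'_le[of 0] by (auto intro!: le_funI simp: A_def)
  \<comment> \<open>At \<open>t = 1\<close> the argument \<open>- y + y\<close> vanishes, leaving
    \<open>q 0 - q y\<close>.\<close>
  show "q' (- y) \<le> - q y"
    using q'_le[of 1 "- y"] sublinear_0[OF q] by (simp add: A_def)
qed

text \<open>Zorn's lemma gives a minimal sublinear functional below \<open>p\<close>; lowering it at
  any \<open>y\<close> changes nothing, so it is odd and hence linear.\<close>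

lemma linear_below_sublinear:
  fixes p :: "'a::real_vector \<Rightarrow> real"
  assumes p: "sublinear p"
  obtains \<phi> where "linear \<phi>" "\<phi> \<le> p"
proof -
  define S where "S = {q. sublinear q \<and> q \<le> p}"
  have "\<exists>m\<in>S. \<forall>a\<in>S. a \<le> m \<longrightarrow> a = m"
  \<comment> \<open>The order is reversed, so maximal elements are minimal functionals and the bound
    of a chain is its pointwise infimum.\<close>
  proof (rule predicate_Zorn)
    show "partial_order_on S (relation_of (\<lambda>a b. b \<le> a) S)"
      by (rule partial_order_on_relation_ofI) auto
    fix C assume C: "C \<in> Chains (relation_of (\<lambda>a b. b \<le> a) S)"
    then have CS: "C \<subseteq> S" and tot: "\<And>a b. a \<in> C \<Longrightarrow> b \<in> C \<Longrightarrow> a \<le> b \<or> b \<le> a"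
      by (auto simp: Chains_def relation_of_def)
    show "\<exists>u\<in>S. \<forall>a\<in>C. u \<le> a"
    proof (cases "C = {}")
      case True
      then show ?thesis using p by (auto simp: S_def)
    next
      case ne: False
      define u where "u x = (INF a\<in>C. a x)" for x
      \<comment> \<open>Being below \<open>p\<close> at \<open>- x\<close> bounds every member of
        the chain from below at \<open>x\<close>.\<close>
      have bdd: "bdd_below ((\<lambda>a. a x) ` C)" for x
      proof (rule bdd_belowI2)
        fix a assume "a \<in> C"
        then have a: "sublinear a" "a (- x) \<le> p (- x)"
          using CS by (auto simp: S_def le_fun_def)
        show "- p (- x) \<le> a x"
          using sublinear_minus_ge[OF a(1), of x] a(2) by linarith
      qed
      have u_le: "u x \<le> a x" if "a \<in> C" for a x
        unfolding u_def by (rule cINF_lower[OF bdd that])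
      have u_ge: "b \<le> u x" if "\<And>a. a \<in> C \<Longrightarrow> b \<le> a x" for b x
        unfolding u_def using that by (intro cINF_greatest ne)
      have sub: "sublinear a" if "a \<in> C" for a
        using that CS by (auto simp: S_def)
      have add: "u (x + y) \<le> u x + u y" for x y
      proof -
        have two: "u (x + y) \<le> a x + b y" if ab: "a \<in> C" "b \<in> C" for a b
        proof -
          \<comment> \<open>Infima of arbitrary families need not be subadditive; in a chain the
            smaller of \<open>a\<close> and \<open>b\<close> serves both summands.\<close>
          from tot[OF ab] obtain c where c: "c \<in> C" "c \<le> a" "c \<le> b"
            using ab by blast
          have "u (x + y) \<le> c (x + y)" by (rule u_le[OF c(1)])
          also have "\<dots> \<le> c x + c y" by (rule sublinear_add[OF sub[OF c(1)]])
          also have "\<dots> \<le> a x + b y" using c(2,3) by (intro add_mono) (auto simp: le_fun_def)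
          finally show ?thesis .
        qed
        have "u (x + y) - a x \<le> u y" if "a \<in> C" for a
          by (rule u_ge) (use two[OF that] in \<open>simp add: algebra_simps\<close>)
        then have "u (x + y) - u y \<le> u x"
          by (intro u_ge) (simp add: algebra_simps)
        then show ?thesis by simp
      qed
      have scale: "u (c *\<^sub>R x) \<le> c * u x" if c: "c > 0" for c x
      proof -
        have "u (c *\<^sub>R x) / c \<le> u x"
        proof (rule u_ge)
          fix a assume a: "a \<in> C"
          have "u (c *\<^sub>R x) \<le> c * a x"
            using u_le[OF a, of "c *\<^sub>R x"] sublinear_scaleR_le[OF sub[OF a] c, of x] by linarith
          then show "u (c *\<^sub>R x) / c \<le> a x"
            using c by (simp add: field_simps)
        qed
        then show ?thesis using c by (simp add: field_simps)
      qed
      obtain a where a: "a \<in> C" using ne by blast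
      then have "a \<le> p" using CS by (auto simp: S_def)
      then have "u \<le> p"
        using u_le[OF a] by (auto simp: le_fun_def intro: order_trans)
      with add scale have "u \<in> S"
        by (simp add: S_def sublinear_def)
      with u_le show ?thesis by (auto simp: le_fun_def)
    qed
  qed
  then obtain m where m: "sublinear m" "m \<le> p" and min: "\<And>a. sublinear a \<Longrightarrow> a \<le> m \<Longrightarrow> a = m"
    unfolding S_def by (blast intro: order_trans)
  have "m (- y) \<le> - m y" for y
    using sublinear_lower_at[OF m(1), of y] min by metis
  then have "linear m" by (rule sublinear_odd_imp_linear[OF m(1)])
  with m(2) show thesis by (rule that[rotated])
qed

text \<open>Lowering \<open>p\<close> at \<open>y\<close> first forces every linear functional below
  the result to reach \<open>p y\<close> at \<open>y\<close>. This replaces extending a functional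
  from the line spanned by \<open>y\<close>.\<close>

lemma sublinear_linear_at:
  fixes p :: "'a::real_vector \<Rightarrow> real"
  assumes "sublinear p"
  obtains \<phi> where "linear \<phi>" "\<phi> \<le> p" "\<phi> y = p y"
proof -
  obtain q where q: "sublinear q" "q \<le> p" "q (- y) \<le> - p y"
    using sublinear_lower_at[OF assms] by blast
  obtain \<phi> where \<phi>: "linear \<phi>" "\<phi> \<le> q"
    using linear_below_sublinear[OF q(1)] by blast
  have "\<phi> (- y) \<le> - p y" "\<phi> y \<le> p y"
    using \<phi>(2) q(2,3) by (auto simp: le_fun_def intro: order_trans)
  then have "\<phi> y = p y"
    using linear_neg[OF \<phi>(1), of y] by simp
  with \<phi> q(2) show thesis
    by (intro that[of \<phi>]) auto
qed

section \<open>Minkowski gauges of convex absorbing sets\<close>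

definition gauge_of :: "'a::real_vector set \<Rightarrow> 'a \<Rightarrow> real" where
  "gauge_of V x = Inf {t. t > 0 \<and> (1 / t) *\<^sub>R x \<in> V}"

lemma gauge_of_le: "t > 0 \<Longrightarrow> (1 / t) *\<^sub>R x \<in> V \<Longrightarrow> gauge_of V x \<le> t"
  unfolding gauge_of_def by (rule cInf_lower) (auto intro!: bdd_belowI[of _ 0])

text \<open>Absorption makes the sets under the infimum nonempty, and convexity gives
  subadditivity.\<close>

lemma gauge_of_sublinear:
  assumes V: "convex V" and absorb: "\<And>x. \<exists>t>0. (1 / t) *\<^sub>R x \<in> V"
  shows "sublinear (gauge_of V)"
proof -
  have ge: "b \<le> gauge_of V x" if "\<And>t. t > 0 \<Longrightarrow> (1 / t) *\<^sub>R x \<in> V \<Longrightarrow> b \<le> t" for b x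
    unfolding gauge_of_def using absorb[of x] that by (intro cInf_greatest) auto
  have add: "gauge_of V (x + y) \<le> gauge_of V x + gauge_of V y" for x y
  proof -
    have two: "gauge_of V (x + y) \<le> t + s"
      if t: "t > 0" "(1 / t) *\<^sub>R x \<in> V" and s: "s > 0" "(1 / s) *\<^sub>R y \<in> V" for t s
    proof (rule gauge_of_le)
      \<comment> \<open>With these weights the convex combination of \<open>x / t\<close> and
        \<open>y / s\<close> is \<open>(x + y) / (t + s)\<close>.\<close>
      have "(t / (t + s)) *\<^sub>R ((1 / t) *\<^sub>R x) + (s / (t + s)) *\<^sub>R ((1 / s) *\<^sub>R y) \<in> V"
        using t s by (intro convexD[OF V]) (auto simp flip: add_divide_distrib)
      then show "(1 / (t + s)) *\<^sub>R (x + y) \<in> V"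
        using t s by (simp add: scaleR_add_right)
    qed (use t s in simp)
    have "gauge_of V (x + y) - t \<le> gauge_of V y" if "t > 0" "(1 / t) *\<^sub>R x \<in> V" for t
      by (rule ge) (use two[OF that] in \<open>simp add: algebra_simps\<close>)
    then have "gauge_of V (x + y) - gauge_of V y \<le> gauge_of V x"
      by (intro ge) (simp add: algebra_simps)
    then show ?thesis by simp
  qed
  have scale: "gauge_of V (c *\<^sub>R x) \<le> c * gauge_of V x" if c: "c > 0" for c x
  proof -
    have "gauge_of V (c *\<^sub>R x) / c \<le> gauge_of V x"
    proof (rule ge)
      fix t :: real assume "t > 0" "(1 / t) *\<^sub>R x \<in> V"
      then have "gauge_of V (c *\<^sub>R x) \<le> c * t"
        using c by (intro gauge_of_le) auto
      then show "gauge_of V (c *\<^sub>R x) / c \<le> t"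
        using c by (simp add: field_simps)
    qed
    then show ?thesis using c by (simp add: field_simps)
  qed
  show ?thesis using add scale by (simp add: sublinear_def)
qed

section \<open>Continuity of linear functionals and nontriviality of the dual\<close>

lemma tendsto_scaleR_lcs:
  fixes g :: "'b \<Rightarrow> 'a::locally_convex_space"
  assumes "(c \<longlongrightarrow> c\<^sub>0) F" "(g \<longlongrightarrow> g\<^sub>0) F"
  shows "((\<lambda>t. c t *\<^sub>R g t) \<longlongrightarrow> c\<^sub>0 *\<^sub>R g\<^sub>0) F"
proof -
  have "filterlim (\<lambda>t. (c t, g t)) (nhds c\<^sub>0 \<times>\<^sub>F nhds g\<^sub>0) F"
    using assms by (rule filterlim_Pair)
  from filterlim_compose[OF tendsto_scaleR_nhds this] show ?thesis by simp
qed

text \<open>The multiples of \<open>x\<close> by \<open>1 / Suc n\<close> tend to \<open>0\<close>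
  and so enter \<open>V\<close>.\<close>

lemma open_absorbing:
  fixes V :: "'a::locally_convex_space set"
  assumes "open V" "0 \<in> V"
  shows "\<exists>t>0. (1 / t) *\<^sub>R x \<in> V"
proof -
  have "((\<lambda>n. (1 / real (Suc n)) *\<^sub>R x) \<longlongrightarrow> 0 *\<^sub>R x) sequentially"
    by (rule tendsto_scaleR_lcs[OF LIMSEQ_Suc[OF lim_1_over_n] tendsto_const])
  then have "eventually (\<lambda>n. (1 / real (Suc n)) *\<^sub>R x \<in> V) sequentially"
    using assms by (auto dest: topological_tendstoD)
  then obtain n where "(1 / real (Suc n)) *\<^sub>R x \<in> V"
    by (auto simp: eventually_sequentially)
  then show ?thesis by (intro exI[of _ "real (Suc n)"]) auto
qed

lemma linear_bounded_above_imp_continuous: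
  fixes \<phi> :: "'a::locally_convex_space \<Rightarrow> real"
  assumes \<phi>: "linear \<phi>" and V: "open V" "0 \<in> V" and le: "\<And>v. v \<in> V \<Longrightarrow> \<phi> v \<le> 1"
  shows "continuous_on UNIV \<phi>"
  unfolding continuous_on_def
proof (intro ballI tendstoI)
  fix x :: 'a and e :: real assume e: "e > 0"
  have lim: "((\<lambda>y. c *\<^sub>R (y - x)) \<longlongrightarrow> c *\<^sub>R (x - x)) (at x)" for c :: real
    by (intro tendsto_scaleR_lcs tendsto_intros)
  have ev: "eventually (\<lambda>y. c *\<^sub>R (y - x) \<in> V) (at x)" for c :: real
    using topological_tendstoD[OF lim V(1)] V(2) by simp
  have "eventually (\<lambda>y. dist (\<phi> y) (\<phi> x) < e) (at x)"
    \<comment> \<open>Using both signs replaces symmetry of \<open>V\<close>; the factor 2 gives a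
      bound of \<open>e / 2\<close>, hence strictly below \<open>e\<close>.\<close>
    using ev[of "2 / e"] ev[of "- (2 / e)"]
  proof eventually_elim
    case (elim y)
    have "(2 / e) * (\<phi> y - \<phi> x) \<le> 1" "- (2 / e) * (\<phi> y - \<phi> x) \<le> 1"
      using le[OF elim(1)] le[OF elim(2)] linear_diff[OF \<phi>] linear_scale[OF \<phi>] linear_neg[OF \<phi>]
      by auto
    then show ?case
      using e by (simp add: dist_real_def abs_if field_simps)
  qed
  then show "eventually (\<lambda>y. dist (\<phi> y) (\<phi> x) < e) (at x within UNIV)" by simp
qed

text \<open>Some convex open neighbourhood \<open>V\<close> of \<open>0\<close> misses a nonzero
  \<open>y\<close>, so its gauge is at least 1 at \<open>y\<close>. A linear functional below the
  gauge and equal to it at \<open>y\<close> is nonzero, and continuous because it is at most 1 on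
  \<open>V\<close>.\<close>

lemma topological_dual_nontrivial:
  assumes "(UNIV :: 'a::locally_convex_space set) \<noteq> {0}"
  obtains \<phi> :: "'a::locally_convex_space \<Rightarrow> real" where "\<phi> \<in> topological_dual" "\<phi> \<noteq> (\<lambda>_. 0)"
proof -
  obtain y :: 'a where "y \<noteq> 0" using assms by auto
  then obtain U :: "'a set" where U: "open U" "0 \<in> U" "y \<notin> U"
    using separation_t1[of 0 y] by auto
  obtain V where V: "open V" "0 \<in> V" "convex V" "V \<subseteq> U"
    using convex_open_nhds_base[OF U(1,2)] by blast
  have sub: "sublinear (gauge_of V)"
    by (rule gauge_of_sublinear[OF V(3) open_absorbing[OF V(1,2)]])
  have "1 \<le> gauge_of V y"
    unfolding gauge_of_def
  proof (rule cInf_greatest)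
    show "{t. 0 < t \<and> (1 / t) *\<^sub>R y \<in> V} \<noteq> {}"
      using open_absorbing[OF V(1,2), of y] by auto
    fix t :: real assume "t \<in> {t. 0 < t \<and> (1 / t) *\<^sub>R y \<in> V}"
    then have t: "t > 0" "(1 / t) *\<^sub>R y \<in> V" by auto
    show "1 \<le> t"
    proof (rule ccontr)
      assume "\<not> 1 \<le> t"
      \<comment> \<open>If \<open>t < 1\<close>, then \<open>y\<close> lies on the segment from
        \<open>0\<close> to a point of \<open>V\<close>, hence in \<open>V\<close>.\<close>
      then have "t *\<^sub>R ((1 / t) *\<^sub>R y) + (1 - t) *\<^sub>R 0 \<in> V"
        using t V(2) by (intro convexD[OF V(3)]) auto
      then show False using t U(3) V(4) by auto
    qed
  qed
  moreover obtain \<phi> where \<phi>: "linear \<phi>" "\<phi> \<le> gauge_of V" "\<phi> y = gauge_of V y"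
    using sublinear_linear_at[OF sub] by blast
  moreover have "\<phi> v \<le> 1" if "v \<in> V" for v
    using gauge_of_le[of 1 v V] le_funD[OF \<phi>(2), of v] that by simp
  then have "continuous_on UNIV \<phi>"
    by (rule linear_bounded_above_imp_continuous[OF \<phi>(1) V(1,2)])
  ultimately show thesis
    by (intro that[of \<phi>]) (auto simp: topological_dual_def)
qed

section \<open>Evenly convex sets and product spaces\<close>

lemma e_convex_UNIV: "e_convex UNIV"
  unfolding e_convex_def by (intro exI[of _ "{}"]) simp

text \<open>The chosen families of half-spaces are united. This is what makes the hull
  \<open>e_conv\<close> evenly convex.\<close>

lemma e_convex_Inter:
  assumes "\<And>C. C \<in> \<C> \<Longrightarrow> e_convex C"
  shows "e_convex (\<Inter>\<C>)"
proof -
  from assms have "\<forall>C\<in>\<C>. \<exists>F. (\<forall>H\<in>F. open_halfspace H) \<and> C = \<Inter>F"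
    by (auto simp: e_convex_def)
  then obtain F where F: "\<forall>C\<in>\<C>. (\<forall>H\<in>F C. open_halfspace H) \<and> C = \<Inter>(F C)"
    by (rule bchoice[THEN exE])
  have "\<Inter>\<C> = (\<Inter>C\<in>\<C>. \<Inter>(F C))"
    using F by (metis (no_types, lifting) INF_cong image_ident)
  also have "\<dots> = \<Inter>(\<Union>C\<in>\<C>. F C)" by blast
  finally have "\<Inter>\<C> = \<Inter>(\<Union>C\<in>\<C>. F C)" .
  moreover have "\<forall>H\<in>(\<Union>C\<in>\<C>. F C). open_halfspace H"
    using F by simp
  ultimately show ?thesis
    unfolding e_convex_def by blast
qed

lemma e_convex_Int: "e_convex A \<Longrightarrow> e_convex B \<Longrightarrow> e_convex (A \<inter> B)"
  using e_convex_Inter[of "{A, B}"] by auto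

lemma e_convex_halfspace:
  assumes "\<phi> \<in> topological_dual" "\<phi> \<noteq> (\<lambda>_. 0)"
  shows "e_convex {y. \<phi> y < c}"
proof -
  have "open_halfspace {y. \<phi> y < c}"
    using assms unfolding open_halfspace_def by blast
  then show ?thesis
    unfolding e_convex_def by (intro exI[of _ "{{y. \<phi> y < c}}"]) simp
qed

lemma topological_dual_uminus:
  fixes \<phi> :: "'a::{real_vector, topological_space} \<Rightarrow> real"
  assumes "\<phi> \<in> topological_dual"
  shows "(\<lambda>y. - \<phi> y) \<in> topological_dual"
  using assms by (auto simp: topological_dual_def intro!: linear_compose_neg continuous_intros)

text \<open>Two opposite open half-spaces are disjoint. Without a nonzero functional there would be
  no half-space, and only \<open>UNIV\<close> would be evenly convex.\<close>

lemma e_convex_empty: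
  fixes \<phi> :: "'a::{real_vector, topological_space} \<Rightarrow> real"
  assumes "\<phi> \<in> topological_dual" "\<phi> \<noteq> (\<lambda>_. 0)"
  shows "e_convex ({} :: 'a set)"
proof -
  have "(\<lambda>y. - \<phi> y) \<noteq> (\<lambda>_. 0)"
    using assms(2) by (auto simp: fun_eq_iff)
  then have "e_convex ({y. \<phi> y < 0} \<inter> {y. - \<phi> y < 0})"
    using assms topological_dual_uminus[OF assms(1)] by (intro e_convex_Int e_convex_halfspace)
  moreover have "{y. \<phi> y < 0} \<inter> {y. - \<phi> y < 0} = {}" by auto
  ultimately show ?thesis by simp
qed

lemma e_convex_separate:
  assumes "e_convex C" "y \<notin> C"
  obtains \<phi> where "\<phi> \<in> topological_dual" "\<And>x. x \<in> C \<Longrightarrow> \<phi> x < \<phi> y"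
proof -
  obtain H where "open_halfspace H" "C \<subseteq> H" "y \<notin> H"
    using assms unfolding e_convex_def by blast
  then obtain \<phi> c where "\<phi> \<in> topological_dual" "H = {y. \<phi> y < c}"
    by (auto simp: open_halfspace_def)
  with \<open>C \<subseteq> H\<close> \<open>y \<notin> H\<close> show thesis
    by (intro that[of \<phi>]) force+
qed

lemma e_conv_e_convex: "e_convex (e_conv C)"
  unfolding e_conv_def by (rule hull_in) (rule e_convex_Inter, blast)

lemma e_conv_superset: "C \<subseteq> e_conv C"
  unfolding e_conv_def by (rule hull_subset)

lemma e_conv_minimal: "C \<subseteq> D \<Longrightarrow> e_convex D \<Longrightarrow> e_conv C \<subseteq> D"
  unfolding e_conv_def by (rule hull_minimal)

lemma e_conv_eq: "e_convex C \<Longrightarrow> e_conv C = C"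
  by (simp add: e_conv_superset e_conv_minimal subset_antisym)

section \<open>Functionals and half-spaces in a product\<close>

lemma topological_dual_Pair:
  fixes \<phi> :: "'a::{real_vector, topological_space} \<Rightarrow> real"
    and \<psi> :: "'b::{real_vector, topological_space} \<Rightarrow> real"
  assumes "\<phi> \<in> topological_dual" "\<psi> \<in> topological_dual"
  shows "(\<lambda>(x, z). \<phi> x + \<psi> z) \<in> topological_dual"
proof -
  have lin: "linear \<phi>" "linear \<psi>" and cont: "continuous_on UNIV \<phi>" "continuous_on UNIV \<psi>"
    using assms by (auto simp: topological_dual_def)
  have "linear (\<lambda>p. \<phi> (fst p) + \<psi> (snd p))"
    by (rule linearI)
      (simp_all add: linear_add[OF lin(1)] linear_add[OF lin(2)] linear_scale[OF lin(1)]
        linear_scale[OF lin(2)] algebra_simps)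
  moreover have "continuous_on UNIV (\<lambda>p. \<phi> (fst p) + \<psi> (snd p))"
    by (intro continuous_on_add continuous_on_compose2[OF cont(1)] continuous_on_compose2[OF cont(2)]
        continuous_intros) auto
  ultimately show ?thesis
    by (simp add: topological_dual_def case_prod_unfold)
qed

lemma topological_dual_zero: "(\<lambda>_. 0) \<in> topological_dual"
  by (simp add: topological_dual_def linear_zero)

text \<open>The components are the restrictions of \<open>\<Phi>\<close> to the two axes.\<close>

lemma topological_dual_split:
  fixes \<Phi> :: "'a::{real_vector, topological_space} \<times> 'b::{real_vector, topological_space} \<Rightarrow> real"
  assumes "\<Phi> \<in> topological_dual"
  obtains \<phi> \<psi> where "\<phi> \<in> topological_dual" "\<psi> \<in> topological_dual" "\<And>x z. \<Phi> (x, z) = \<phi> x + \<psi> z"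
proof
  have lin: "linear \<Phi>" and cont: "continuous_on UNIV \<Phi>"
    using assms by (auto simp: topological_dual_def)
  have "linear (\<lambda>x. \<Phi> (x, 0))"
    by (rule linearI)
      (use linear_add[OF lin, of "(_, 0)" "(_, 0)"] linear_scale[OF lin, of _ "(_, 0)"] in simp_all)
  moreover have "continuous_on UNIV (\<lambda>x. \<Phi> (x, 0))"
    by (intro continuous_on_compose2[OF cont] continuous_intros) auto
  ultimately show "(\<lambda>x. \<Phi> (x, 0)) \<in> topological_dual"
    by (simp add: topological_dual_def)
  have "linear (\<lambda>z. \<Phi> (0, z))"
    by (rule linearI)
      (use linear_add[OF lin, of "(0, _)" "(0, _)"] linear_scale[OF lin, of _ "(0, _)"] in simp_all)
  moreover have "continuous_on UNIV (\<lambda>z. \<Phi> (0, z))"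
    by (intro continuous_on_compose2[OF cont] continuous_intros) auto
  ultimately show "(\<lambda>z. \<Phi> (0, z)) \<in> topological_dual"
    by (simp add: topological_dual_def)
  show "\<Phi> (x, z) = \<Phi> (x, 0) + \<Phi> (0, z)" for x z
    using linear_add[OF lin, of "(x, 0)" "(0, z)"] by simp
qed

lemma e_convex_halfspace_Pair:
  fixes \<phi> :: "'a::{real_vector, topological_space} \<Rightarrow> real"
    and \<psi> :: "'b::{real_vector, topological_space} \<Rightarrow> real"
  assumes "\<phi> \<in> topological_dual" "\<psi> \<in> topological_dual" "\<phi> \<noteq> (\<lambda>_. 0) \<or> \<psi> \<noteq> (\<lambda>_. 0)"
  shows "e_convex {(x, z). \<phi> x + \<psi> z < c}"
proof -
  have 0: "\<phi> 0 = 0" "\<psi> 0 = 0"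
    using assms(1,2) by (auto simp: topological_dual_def linear_0)
  have "(\<lambda>(x, z). \<phi> x + \<psi> z) \<noteq> (\<lambda>_. 0)"
  proof
    assume eq: "(\<lambda>(x, z). \<phi> x + \<psi> z) = (\<lambda>_. 0)"
    have "\<phi> x = 0" "\<psi> z = 0" for x z
      using fun_cong[OF eq, of "(x, 0)"] fun_cong[OF eq, of "(0, z)"] 0 by auto
    with assms(3) show False by auto
  qed
  from e_convex_halfspace[OF topological_dual_Pair[OF assms(1,2)] this, of c] show ?thesis
    by (simp add: case_prod_unfold)
qed

text \<open>The cylinder over a half-space is a half-space whose functional has second component
  zero. It handles the empty epigraph and the restriction of minorants to
  \<open>M_set f\<close>.\<close>

lemma e_convex_Times_UNIV:
  fixes C :: "'a::{real_vector, topological_space} set"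
  assumes "e_convex C"
  shows "e_convex (C \<times> (UNIV :: 'b::{real_vector, topological_space} set))"
proof -
  obtain F where F: "\<And>H. H \<in> F \<Longrightarrow> open_halfspace H" "C = \<Inter>F"
    using assms by (auto simp: e_convex_def)
  have "e_convex (H \<times> (UNIV :: 'b set))" if "H \<in> F" for H
  proof -
    have "open_halfspace H" by (rule F(1)[OF that])
    then obtain \<phi> c where \<phi>: "\<phi> \<in> topological_dual" "\<phi> \<noteq> (\<lambda>_. 0)" "H = {y. \<phi> y < c}"
      by (auto simp: open_halfspace_def)
    have "H \<times> (UNIV :: 'b set) = {(x, z). \<phi> x + (\<lambda>_. 0) z < c}"
      using \<phi>(3) by auto
    with e_convex_halfspace_Pair[OF \<phi>(1) topological_dual_zero, of c] \<phi>(2) show ?thesis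
      by metis
  qed
  then have "e_convex (\<Inter>((\<lambda>H. H \<times> (UNIV :: 'b set)) ` F))"
    by (intro e_convex_Inter) auto
  moreover have "\<Inter>((\<lambda>H. H \<times> (UNIV :: 'b set)) ` F) = C \<times> UNIV"
    using F(2) by auto
  ultimately show ?thesis by simp
qed

section \<open>Affine minorants\<close>

lemma linear_functional_surj:
  fixes \<psi> :: "'a::real_vector \<Rightarrow> real"
  assumes "linear \<psi>" "\<psi> \<noteq> (\<lambda>_. 0)"
  obtains w where "\<psi> w = c"
proof -
  obtain v where "\<psi> v \<noteq> 0" using assms(2) by auto
  then have "\<psi> ((c / \<psi> v) *\<^sub>R v) = c"
    by (simp add: linear_scale[OF assms(1)])
  then show thesis by (rule that)
qed

text \<open>Translating by \<open>w\<close> moves the threshold from \<open>0\<close> to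
  \<open>\<psi> w\<close>, so affine functions can be handled through a real threshold.\<close>

lemma S_fun_translate:
  assumes "linear \<psi>"
  shows "S_fun \<phi> \<psi> x + {w} = {z. \<phi> x + \<psi> z < \<psi> w}"
proof -
  have "z \<in> S_fun \<phi> \<psi> x + {w} \<longleftrightarrow> z - w \<in> S_fun \<phi> \<psi> x" for z
    by (auto simp: set_plus_def intro!: bexI[of _ "z - w"])
  moreover have "z - w \<in> S_fun \<phi> \<psi> x \<longleftrightarrow> \<phi> x + \<psi> z < \<psi> w" for z
    by (auto simp: S_fun_def linear_diff[OF assms])
  ultimately show ?thesis by blast
qed

lemma C_affine_halfspaceE:
  assumes "C_affine K C a"
  obtains \<phi> \<psi> c where "\<phi> \<in> topological_dual" "\<psi> \<in> polar_cone K" "\<psi> \<noteq> (\<lambda>_. 0)"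
    "a = (\<lambda>x. if x \<in> C then {z. \<phi> x + \<psi> z < c} else {})"
proof -
  obtain \<phi> \<psi> w where *: "\<phi> \<in> topological_dual" "\<psi> \<in> polar_cone K - {\<lambda>_. 0}"
    "\<And>x. a x = (if x \<in> C then S_fun \<phi> \<psi> x + {w} else {})"
    using assms by (auto simp: C_affine_def)
  have lin: "linear \<psi>" using *(2) by (auto simp: polar_cone_def topological_dual_def)
  show thesis
    using * by (intro that[of \<phi> \<psi> "\<psi> w"] ext) (auto simp: S_fun_translate[OF lin])
qed

text \<open>A nonzero functional takes every real value, so some translation vector \<open>w\<close>
  realizes the threshold \<open>c\<close>.\<close>

lemma C_affine_halfspaceI:
  assumes "\<phi> \<in> topological_dual" "\<psi> \<in> polar_cone K" "\<psi> \<noteq> (\<lambda>_. 0)"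
  shows "C_affine K C (\<lambda>x. if x \<in> C then {z. \<phi> x + \<psi> z < c} else {})"
proof -
  have lin: "linear \<psi>" using assms(2) by (auto simp: polar_cone_def topological_dual_def)
  obtain w where "\<psi> w = c" using linear_functional_surj[OF lin assms(3)] .
  with assms show ?thesis
    unfolding C_affine_def
    by (intro bexI[of _ \<phi>] bexI[of _ \<psi>] exI[of _ w]) (auto simp: S_fun_translate[OF lin])
qed

section \<open>Adding the cone, and minorants built from half-spaces\<close>

lemma set_plus_cone_superset:
  fixes A K :: "'a::monoid_add set"
  shows "0 \<in> K \<Longrightarrow> A \<subseteq> A + K"
  by (force simp: set_plus_def)

lemma set_plus_cone_idem:
  fixes A K :: "'a::real_vector set"
  assumes "convex_cone K"
  shows "A + K + K = A + K"
proof -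
  have "K + K = K"
    using assms set_plus_cone_superset[OF convex_cone_contains_0[OF assms], of K]
    by (auto simp: set_plus_def convex_cone_add)
  then show ?thesis by (simp add: add.assoc)
qed

text \<open>Adding an element of \<open>K\<close> can only lower \<open>\<psi>\<close>.\<close>

lemma polar_halfspace_plus:
  assumes "convex_cone K" "\<psi> \<in> polar_cone K"
  shows "{z. c + \<psi> z < d} + K = {z. c + \<psi> z < d}"
proof -
  have "linear \<psi>" "\<And>k. k \<in> K \<Longrightarrow> \<psi> k \<le> 0"
    using assms(2) by (auto simp: polar_cone_def topological_dual_def)
  then have "{z. c + \<psi> z < d} + K \<subseteq> {z. c + \<psi> z < d}"
    by (force simp: set_plus_def linear_add)
  then show ?thesis
    by (rule subset_antisym) (rule set_plus_cone_superset[OF convex_cone_contains_0[OF assms(1)]])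
qed

lemma R_sets_plus:
  assumes "convex_cone K" "A \<in> R_sets K"
  shows "A + K = A"
  using assms e_conv_superset[of "A + K"]
    set_plus_cone_superset[OF convex_cone_contains_0[OF assms(1)], of A]
  by (auto simp: R_sets_def)

lemma halfspace_not_UNIV:
  fixes \<psi> :: "'a::real_vector \<Rightarrow> real"
  assumes "linear \<psi>" "\<psi> \<noteq> (\<lambda>_. 0)"
  shows "{z. c + \<psi> z < d} \<noteq> UNIV"
proof -
  obtain w where "\<psi> w = d - c" using linear_functional_surj[OF assms] .
  then have "w \<notin> {z. c + \<psi> z < d}" by simp
  then show ?thesis by blast
qed

text \<open>Each value is an open half-space or empty, hence evenly convex, and is stable under
  adding \<open>K\<close>; this puts it in \<open>R_sets K\<close>. Off \<open>M_set f\<close> the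
  empty value is harmless because \<open>f\<close> is empty there.\<close>

lemma halfspace_minorant:
  fixes f :: "'x::locally_convex_space \<Rightarrow> 'z::locally_convex_space set"
  assumes K: "convex_cone K" and f: "f \<noteq> (\<lambda>_. {})"
    and \<phi>: "\<phi> \<in> topological_dual" and \<psi>: "\<psi> \<in> polar_cone K" "\<psi> \<noteq> (\<lambda>_. 0)"
    and le: "\<And>x z. z \<in> f x \<Longrightarrow> \<phi> x + \<psi> z < c"
  shows "(\<lambda>x. if x \<in> M_set f then {z. \<phi> x + \<psi> z < c} else {}) \<in> affine_minorants K f"
    (is "?a \<in> _")
proof -
  have dual: "\<psi> \<in> topological_dual" using \<psi>(1) by (simp add: polar_cone_def)
  have e: "e_convex (?a x)" for x
    using e_convex_halfspace[OF dual \<psi>(2), of "c - \<phi> x"] e_convex_empty[OF dual \<psi>(2)]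
    by (simp add: algebra_simps)
  have plus: "?a x + K = ?a x" for x
    using polar_halfspace_plus[OF K \<psi>(1)] by (simp add: set_plus_def)
  have R: "?a x \<in> R_sets K" for x
    unfolding R_sets_def using e_conv_eq[OF e, of x] plus[of x] by simp
  have "f x \<subseteq> ?a x" for x
    using e_conv_superset[of "sv_dom f"] le by (auto simp: M_set_def sv_dom_def)
  then have "le_cone K (?a x) (f x)" for x
    unfolding le_cone_def plus .
  then show ?thesis
    using f R C_affine_halfspaceI[OF \<phi> \<psi>] by (simp add: affine_minorants_def)
qed

section \<open>Separating points from the epigraph by minorants\<close>

lemma bounded_on_cone_imp_polar:
  assumes "convex_cone K" "\<psi> \<in> topological_dual"
    and bound: "\<And>k. k \<in> K \<Longrightarrow> \<psi> k \<le> b"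
  shows "\<psi> \<in> polar_cone K"
proof -
  have lin: "linear \<psi>" using assms(2) by (simp add: topological_dual_def)
  have "\<psi> k \<le> 0" if k: "k \<in> K" for k
  proof (rule ccontr)
    assume pos: "\<not> \<psi> k \<le> 0"
    \<comment> \<open>A positive value could be scaled within the cone to
      \<open>\<bar>b\<bar> + 1\<close>, beyond the bound.\<close>
    define t where "t = (\<bar>b\<bar> + 1) / \<psi> k"
    have "t *\<^sub>R k \<in> K"
      using pos k by (intro convex_cone_scaleR[OF assms(1)]) (auto simp: t_def)
    from bound[OF this] have "\<bar>b\<bar> + 1 \<le> b"
      using pos by (simp add: linear_scale[OF lin] t_def)
    then show False by simp
  qed
  with assms(2) show ?thesis by (simp add: polar_cone_def)
qed

text \<open>Membership of \<open>x\<^sub>0\<close> in \<open>M_set f\<close> rules out a vertical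
  separating hyperplane, so the separating functional yields a minorant.\<close>

lemma minorant_separating:
  fixes f :: "'x::locally_convex_space \<Rightarrow> 'z::locally_convex_space set"
  assumes K: "convex_cone K" and f: "f \<noteq> (\<lambda>_. {})" and conv: "K_e_convex K f"
    and x\<^sub>0: "x\<^sub>0 \<in> M_set f" and z\<^sub>0: "z\<^sub>0 \<notin> f x\<^sub>0 + K"
  shows "\<exists>a\<in>affine_minorants K f. z\<^sub>0 \<notin> a x\<^sub>0 + K"
proof -
  have "(x\<^sub>0, z\<^sub>0) \<notin> sv_epi K f" using z\<^sub>0 by (simp add: sv_epi_def)
  then obtain \<Phi> where \<Phi>: "\<Phi> \<in> topological_dual" "\<And>p. p \<in> sv_epi K f \<Longrightarrow> \<Phi> p < \<Phi> (x\<^sub>0, z\<^sub>0)"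
    using conv e_convex_separate unfolding K_e_convex_def by blast
  obtain \<phi> \<psi> where \<phi>: "\<phi> \<in> topological_dual" and \<psi>: "\<psi> \<in> topological_dual"
    and split: "\<And>x z. \<Phi> (x, z) = \<phi> x + \<psi> z"
    using topological_dual_split[OF \<Phi>(1)] by blast
  \<comment> \<open>With the value at the separated point as threshold, the strict inequality
    excludes \<open>z\<^sub>0\<close> from the minorant at \<open>x\<^sub>0\<close>.\<close>
  define c where "c = \<phi> x\<^sub>0 + \<psi> z\<^sub>0"
  have less: "\<phi> x + \<psi> z < c" if "z \<in> f x + K" for x z
    using \<Phi>(2)[of "(x, z)"] that by (simp add: sv_epi_def split c_def)
  have less': "\<phi> x + \<psi> z < c" if "z \<in> f x" for x z
    using less that set_plus_cone_superset[OF convex_cone_contains_0[OF K], of "f x"] by blast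
  have linpsi: "linear \<psi>" using \<psi> by (simp add: topological_dual_def)
  obtain x\<^sub>1 z\<^sub>1 where 1: "z\<^sub>1 \<in> f x\<^sub>1" using f by (auto simp: fun_eq_iff)
  have polar: "\<psi> \<in> polar_cone K"
  proof (rule bounded_on_cone_imp_polar[OF K \<psi>])
    fix k assume "k \<in> K"
    \<comment> \<open>The epigraph contains a translate of \<open>K\<close> over
      \<open>x\<^sub>1\<close>, so \<open>\<psi>\<close> is bounded above on
      \<open>K\<close>.\<close>
    with 1 have "z\<^sub>1 + k \<in> f x\<^sub>1 + K" by (rule set_plus_intro)
    from less[OF this] show "\<psi> k \<le> c - \<phi> x\<^sub>1 - \<psi> z\<^sub>1"
      by (simp add: linear_add[OF linpsi])
  qed
  have nz: "\<psi> \<noteq> (\<lambda>_. 0)"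
  proof
    assume "\<psi> = (\<lambda>_. 0)"
    then have dom: "sv_dom f \<subseteq> {x. \<phi> x < \<phi> x\<^sub>0}"
      using less' by (auto simp: sv_dom_def c_def)
    \<comment> \<open>If \<open>\<phi>\<close> vanished as well, the domain would be empty, contrary
      to the existence of \<open>x\<^sub>1\<close>.\<close>
    moreover have "\<phi> \<noteq> (\<lambda>_. 0)" using dom 1 by (auto simp: sv_dom_def)
    ultimately have "M_set f \<subseteq> {x. \<phi> x < \<phi> x\<^sub>0}"
      unfolding M_set_def by (intro e_conv_minimal e_convex_halfspace[OF \<phi>])
    with x\<^sub>0 show False by blast
  qed
  show ?thesis
    using polar_halfspace_plus[OF K polar, of "\<phi> x\<^sub>0" c] x\<^sub>0
    by (intro bexI[OF _ halfspace_minorant[OF K f \<phi> polar nz less']]) (simp_all add: c_def)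
qed

section \<open>Properties of minorants and of their supremum\<close>

lemma minorant_plus:
  assumes "convex_cone K" "f \<noteq> (\<lambda>_. {})" "a \<in> affine_minorants K f"
  shows "a x + K = a x"
proof (rule R_sets_plus[OF assms(1)])
  show "a x \<in> R_sets K" using assms(2,3) by (simp add: affine_minorants_def)
qed

lemma minorant_halfspaceE:
  fixes f :: "'x::locally_convex_space \<Rightarrow> 'z::locally_convex_space set"
  assumes "f \<noteq> (\<lambda>_. {})" "a \<in> affine_minorants K f"
  obtains \<phi> \<psi> c where "\<phi> \<in> topological_dual" "\<psi> \<in> topological_dual" "\<psi> \<noteq> (\<lambda>_. 0)"
    "a = (\<lambda>x. if x \<in> M_set f then {z. \<phi> x + \<psi> z < c} else {})"
proof -
  have "C_affine K (M_set f) a" using assms by (simp add: affine_minorants_def)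
  then obtain \<phi> \<psi> c where "\<phi> \<in> topological_dual" "\<psi> \<in> polar_cone K" "\<psi> \<noteq> (\<lambda>_. 0)"
    "a = (\<lambda>x. if x \<in> M_set f then {z. \<phi> x + \<psi> z < c} else {})"
    by (rule C_affine_halfspaceE)
  then show thesis
    by (intro that[of \<phi> \<psi> c]) (simp_all add: polar_cone_def)
qed

lemma minorant_not_UNIV:
  assumes f: "f \<noteq> (\<lambda>_. {})" and a: "a \<in> affine_minorants K f"
  shows "a x \<noteq> UNIV"
proof -
  obtain \<phi> \<psi> c where "\<psi> \<in> topological_dual" "\<psi> \<noteq> (\<lambda>_. 0)"
    and a_eq: "a = (\<lambda>x. if x \<in> M_set f then {z. \<phi> x + \<psi> z < c} else {})"
    by (rule minorant_halfspaceE[OF f a])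
  then have "{z. \<phi> x + \<psi> z < c} \<noteq> UNIV"
    by (intro halfspace_not_UNIV) (auto simp: topological_dual_def)
  then show ?thesis by (simp add: a_eq)
qed

lemma minorant_superset:
  assumes "convex_cone K" "f \<noteq> (\<lambda>_. {})" "a \<in> affine_minorants K f"
  shows "f x + K \<subseteq> a x"
proof -
  have "f x \<subseteq> a x"
    using assms minorant_plus[OF assms, of x] by (auto simp: affine_minorants_def le_cone_def)
  then have "f x + K \<subseteq> a x + K" by (rule set_plus_mono2) simp
  then show ?thesis by (simp add: minorant_plus[OF assms])
qed

text \<open>The epigraph of \<open>f\<close> is the intersection of those of the minorants, each
  being a half-space cut with the cylinder over \<open>M_set f\<close>.\<close>

lemma supremum_of_minorants_imp_e_convex:
  fixes f :: "'x::locally_convex_space \<Rightarrow> 'z::locally_convex_space set"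
  assumes K: "convex_cone K" and f: "f \<noteq> (\<lambda>_. {})" and ne: "affine_minorants K f \<noteq> {}"
    and sup: "\<And>x. f x + K = (\<Inter>a\<in>affine_minorants K f. a x + K)"
  shows "K_e_convex K f"
proof -
  have epi: "sv_epi K f = (\<Inter>a\<in>affine_minorants K f. {(x, z). z \<in> a x})"
    using minorant_plus[OF K f] by (auto simp: sv_epi_def sup)
  have "e_convex {(x, z). z \<in> a x}" if a: "a \<in> affine_minorants K f" for a
  proof -
    obtain \<phi> \<psi> c where \<phi>: "\<phi> \<in> topological_dual" and \<psi>: "\<psi> \<in> topological_dual" "\<psi> \<noteq> (\<lambda>_. 0)"
      and a_eq: "a = (\<lambda>x. if x \<in> M_set f then {z. \<phi> x + \<psi> z < c} else {})"
      by (rule minorant_halfspaceE[OF f a])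
    have "{(x, z). z \<in> a x} = M_set f \<times> UNIV \<inter> {(x, z). \<phi> x + \<psi> z < c}"
      by (auto simp: a_eq split: if_splits)
    moreover have "e_convex (M_set f \<times> (UNIV :: 'z set) \<inter> {(x, z). \<phi> x + \<psi> z < c})"
      using \<phi> \<psi> unfolding M_set_def
      by (intro e_convex_Int e_convex_Times_UNIV e_conv_e_convex e_convex_halfspace_Pair) auto
    ultimately show ?thesis by simp
  qed
  then show ?thesis
    unfolding K_e_convex_def epi by (intro e_convex_Inter) auto
qed

theorem theorem2:
  fixes K :: "'z::locally_convex_space set"
    and f :: "'x::locally_convex_space \<Rightarrow> 'z set"
  assumes "(UNIV :: 'x set) \<noteq> {0}" and "(UNIV :: 'z set) \<noteq> {0}"
    and "convex_cone K" and "{0} \<subset> K" and "K \<subset> UNIV"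
  shows "(\<forall>x. f x + K = (\<Inter>a\<in>affine_minorants K f. a x + K)) \<longleftrightarrow>
         K_e_convex K f \<and>
         (sv_proper (sv_plus K f) \<or> (\<forall>x. sv_plus K f x = {}) \<or> (\<forall>x. sv_plus K f x = UNIV))"
proof (cases "f = (\<lambda>_. {})")
  case True
  \<comment> \<open>The only minorant is \<open>f\<close> itself, so the supremum formula is
    trivial; even convexity of the empty epigraph remains.\<close>
  obtain \<phi> :: "'x \<Rightarrow> real" where "\<phi> \<in> topological_dual" "\<phi> \<noteq> (\<lambda>_. 0)"
    using topological_dual_nontrivial[OF assms(1)] .
  then have "e_convex ({} \<times> (UNIV :: 'z set) :: ('x \<times> 'z) set)"
    by (intro e_convex_Times_UNIV e_convex_empty)
  moreover have "{} + K = {}" by (simp add: set_plus_def)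
  ultimately show ?thesis
    by (simp add: True affine_minorants_def K_e_convex_def sv_epi_def sv_plus_def)
next
  case f: False
  note K = assms(3)
  have K0: "0 \<in> K" by (rule convex_cone_contains_0[OF K])
  have dom: "sv_dom (sv_plus K f) = sv_dom f"
    using K0 by (auto simp: sv_dom_def sv_plus_def set_plus_def)
  have dom_ne: "sv_dom f \<noteq> {}" using f by (auto simp: sv_dom_def fun_eq_iff)
  show ?thesis
  proof
    assume sup: "\<forall>x. f x + K = (\<Inter>a\<in>affine_minorants K f. a x + K)"
    show "K_e_convex K f \<and>
      (sv_proper (sv_plus K f) \<or> (\<forall>x. sv_plus K f x = {}) \<or> (\<forall>x. sv_plus K f x = UNIV))"
    proof (cases "affine_minorants K f = {}")
      case True
      with sup have "\<forall>x. f x + K = UNIV" by simp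
      then show ?thesis
        by (simp add: K_e_convex_def sv_epi_def sv_plus_def e_convex_UNIV)
    next
      case False
      then obtain a where a: "a \<in> affine_minorants K f" by blast
      have "sv_proper (sv_plus K f)"
        unfolding sv_proper_def dom using dom_ne
      proof (intro conjI ballI)
        fix x
        show "sv_plus K f x \<noteq> UNIV"
          using minorant_superset[OF K f a, of x] minorant_not_UNIV[OF f a, of x]
          by (auto simp: sv_plus_def)
      qed
      then show ?thesis
        using supremum_of_minorants_imp_e_convex[OF K f False] sup by blast
    qed
  next
    assume *: "K_e_convex K f \<and>
      (sv_proper (sv_plus K f) \<or> (\<forall>x. sv_plus K f x = {}) \<or> (\<forall>x. sv_plus K f x = UNIV))"
    \<comment> \<open>As \<open>f\<close> has nonempty domain and \<open>0 \<in> K\<close>, the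
      alternative of empty values everywhere cannot occur.\<close>
    then consider (proper) "sv_proper (sv_plus K f)" | (univ) "\<forall>x. sv_plus K f x = UNIV"
      using dom dom_ne by (auto simp: sv_dom_def)
    then show "\<forall>x. f x + K = (\<Inter>a\<in>affine_minorants K f. a x + K)"
    proof cases
      case univ
      have "affine_minorants K f = {}"
      proof (rule equals0I)
        fix a assume a: "a \<in> affine_minorants K f"
        show False
          using minorant_superset[OF K f a, of 0] minorant_not_UNIV[OF f a, of 0] univ
          by (auto simp: sv_plus_def)
      qed
      with univ show ?thesis by (simp add: sv_plus_def)
    next
      case proper
      note sep = minorant_separating[OF K f conjunct1[OF *]]
      \<comment> \<open>Properness yields a point outside the epigraph over the domain; separating
        it shows that at least one minorant exists.\<close>
      obtain x\<^sub>1 where x\<^sub>1: "x\<^sub>1 \<in> sv_dom f" "f x\<^sub>1 + K \<noteq> UNIV"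
        using proper dom_ne unfolding sv_proper_def dom by (auto simp: sv_plus_def)
      then obtain z\<^sub>1 where "z\<^sub>1 \<notin> f x\<^sub>1 + K" by blast
      moreover have "x\<^sub>1 \<in> M_set f"
        using x\<^sub>1(1) e_conv_superset[of "sv_dom f"] by (auto simp: M_set_def)
      ultimately obtain a\<^sub>1 where a\<^sub>1: "a\<^sub>1 \<in> affine_minorants K f"
        using sep by blast
      show ?thesis
      proof (intro allI equalityI subsetI)
        fix x z assume "z \<in> f x + K"
        then show "z \<in> (\<Inter>a\<in>affine_minorants K f. a x + K)"
          using minorant_superset[OF K f] minorant_plus[OF K f] by blast
      next
        fix x z assume z: "z \<in> (\<Inter>a\<in>affine_minorants K f. a x + K)"
        \<comment> \<open>The minorant \<open>a\<^sub>1\<close> is empty off \<open>M_set f\<close>,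
          so \<open>x\<close> lies in \<open>M_set f\<close>, where separation is available.\<close>
        have "a\<^sub>1 x \<noteq> {}" using z a\<^sub>1 minorant_plus[OF K f a\<^sub>1, of x] by blast
        then have "x \<in> M_set f"
          by - (rule minorant_halfspaceE[OF f a\<^sub>1], simp split: if_splits)
        with z show "z \<in> f x + K"
          using sep by blast
      qed
    qed
  qed
qed

end
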